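(* Let $H$ be an oriented graph on $k$ vertices and let $D$ be an oriented graph on $n$ vertices with $bias(D)<\varepsilon n^{2}$. Then $$hom(H,D)\ge \frac{hom(\bar H,D)}{3^{e(H)}}-\frac{\varepsilon}{2}n^{k}.$$
   Context: An oriented graph is a finite directed graph without loops in which, for each pair of distinct vertices $x,y$, at most one of $\vec{xy},\vec{yx}$ is an arc. $V(D)$, $E(D)$ are the vertex and arc sets of $D$ and $e(H)$ is the number of arcs of $H$. For (not necessarily disjoint) $A,B\subseteq V(D)$, $e(A,B)$ is the number of arcs $\vec{xy}$ of $D$ with $x\in A$, $y\in B$, and $$bias(D)=\max\{e(A,B): A,B\subseteq V(D),\ e(B,A)\le e(A,B)/2\}.$$ $hom(H,D)$ is the number of functions $\phi:V(H)\to V(D)$ such that $\vec{\phi(x)\phi(y)}\in E(D)$ for every arc $\vec{xy}\in E(H)$. $\bar H$ is the underlying unoriented graph of $H$, and $hom(\bar H,D)$ is the number of functions $\phi:V(H)\to V(D)$ such that for every edge $\{x,y\}\in E(\bar H)$ either $\vec{\phi(x)\phi(y)}$ or $\vec{\phi(y)\phi(x)}$ is an arc of $D$. *)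

theory Defs
  imports Complex_Main "HOL-Library.FuncSet" "Graph_Theory.Graph_Theory"
begin

locale oriented_graph = pair_digraph +
  assumes no_opposite_arcs: "(x, y) \<in> parcs G \<Longrightarrow> (y, x) \<notin> parcs G"

definition arcs_from_to :: "'a pair_pre_digraph \<Rightarrow> 'a set \<Rightarrow> 'a set \<Rightarrow> nat" where
  "arcs_from_to D A B = card {(x, y). (x, y) \<in> parcs D \<and> x \<in> A \<and> y \<in> B}"

definition bias_values :: "'a pair_pre_digraph \<Rightarrow> nat set" where
  "bias_values D = {arcs_from_to D A B | A B. A \<subseteq> pverts D \<and> B \<subseteq> pverts D \<and>
     real (arcs_from_to D B A) \<le> real (arcs_from_to D A B) / 2}"

definition bias :: "'a pair_pre_digraph \<Rightarrow> nat" where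
  "bias D = Max (bias_values D)"

text \<open>The maximum is attained, over a finite nonempty set, whenever \<open>D\<close> has finitely many
  vertices.\<close>

lemma finite_bias_values:
  assumes "finite (pverts D)"
  shows "finite (bias_values D)"
proof (rule finite_subset)
  show "bias_values D \<subseteq> (\<lambda>(A, B). arcs_from_to D A B) ` (Pow (pverts D) \<times> Pow (pverts D))"
    by (auto simp: bias_values_def)
  show "finite ((\<lambda>(A, B). arcs_from_to D A B) ` (Pow (pverts D) \<times> Pow (pverts D)))"
    using assms by simp
qed

lemma bias_values_nonempty: "bias_values D \<noteq> {}"
proof -
  have "arcs_from_to D {} {} \<in> bias_values D"
    unfolding bias_values_def
    by (intro CollectI exI[of _ "{}"]) (simp add: arcs_from_to_def)
  then show ?thesis by blast
qed

text \<open>A function between vertex sets is an element of the extensional function space, so that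
  functions agreeing on the vertices of \<open>H\<close> are counted once.\<close>

definition hom_count :: "'a pair_pre_digraph \<Rightarrow> 'b pair_pre_digraph \<Rightarrow> nat" where
  "hom_count H D = card {\<phi> \<in> PiE (pverts H) (\<lambda>_. pverts D).
     \<forall>(x, y) \<in> parcs H. (\<phi> x, \<phi> y) \<in> parcs D}"

text \<open>The first argument stands for an undirected graph, represented as in the library by a
  symmetric digraph; an edge between \<open>x\<close> and \<open>y\<close> is the pair of arcs \<open>(x, y)\<close>, \<open>(y, x)\<close>, which
  impose the same condition. The underlying unoriented graph of \<open>H\<close> is \<open>mk_symmetric H\<close>.\<close>

definition unoriented_hom_count :: "'a pair_pre_digraph \<Rightarrow> 'b pair_pre_digraph \<Rightarrow> nat" where
  "unoriented_hom_count U D = card {\<phi> \<in> PiE (pverts U) (\<lambda>_. pverts D).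
     \<forall>(x, y) \<in> parcs U. (\<phi> x, \<phi> y) \<in> parcs D \<or> (\<phi> y, \<phi> x) \<in> parcs D}"

end

theory Submission
  imports Defs
begin

text \<open>Turn the edges of \<open>H\<close> into arcs one at a time. When the edge \<open>uv\<close> is oriented, fix the
  images of all vertices other than \<open>u\<close> and \<open>v\<close>. As no other arc joins \<open>u\<close> and \<open>v\<close>, the remaining
  constraints say that the image of \<open>u\<close> lies in a set \<open>A\<close> and that of \<open>v\<close> in a set \<open>B\<close>, and the
  count drops from \<open>e(A,B) + e(B,A)\<close> to \<open>e(A,B)\<close>. Since \<open>e(B,A) \<le> 2 e(A,B) + bias(D)\<close>, this loses
  at most a factor \<open>3\<close> and an additive \<open>\<epsilon> n\<^sup>k / 3\<close>; the additive losses sum to at most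
  \<open>(\<epsilon> / 3) (1 + 1/3 + 1/9 + \<dots>) n\<^sup>k = (\<epsilon> / 2) n\<^sup>k\<close>.\<close>

text \<open>If at most half as many arcs go from \<open>A\<close> to \<open>B\<close> as from
  \<open>B\<close> to \<open>A\<close>, the pair \<open>(B, A)\<close> competes in the maximum
  defining \<open>bias D\<close>; otherwise the factor 2 alone suffices.\<close>

lemma arcs_from_to_le_bias:
  assumes "finite (pverts D)" "A \<subseteq> pverts D" "B \<subseteq> pverts D"
  shows "arcs_from_to D B A \<le> 2 * arcs_from_to D A B + bias D"
proof (cases "real (arcs_from_to D A B) \<le> real (arcs_from_to D B A) / 2")
  case True
  then have "arcs_from_to D B A \<in> bias_values D"
    using assms unfolding bias_values_def by blast
  then have "arcs_from_to D B A \<le> bias D"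
    unfolding bias_def using finite_bias_values[OF assms(1)] by (rule Max_ge[rotated])
  then show ?thesis by simp
next
  case False
  then show ?thesis by linarith
qed

context oriented_graph
begin

lemma card_adjacent_pairs_le:
  assumes "A \<subseteq> pverts G" "B \<subseteq> pverts G"
  shows "card {(a, b) \<in> A \<times> B. (a, b) \<in> parcs G \<or> (b, a) \<in> parcs G}
    \<le> 3 * card {(a, b) \<in> A \<times> B. (a, b) \<in> parcs G} + bias G"
proof -
  let ?F = "{(a, b) \<in> A \<times> B. (a, b) \<in> parcs G}"
  let ?R = "{(a, b) \<in> A \<times> B. (b, a) \<in> parcs G}"
  have "card {(a, b) \<in> A \<times> B. (a, b) \<in> parcs G \<or> (b, a) \<in> parcs G} = card (?F \<union> ?R)"
    by (rule arg_cong[where f = card]) auto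
  also have "\<dots> \<le> card ?F + card ?R"
    by (rule card_Un_le)
  also have "card ?F = arcs_from_to G A B"
    unfolding arcs_from_to_def by (rule arg_cong[where f = card]) auto
  also have "card ?R = arcs_from_to G B A"
    unfolding arcs_from_to_def
    by (rule bij_betw_same_card[of prod.swap], rule bij_betw_byWitness[of _ prod.swap]) auto
  finally show ?thesis
    using arcs_from_to_le_bias[OF pair_finite_verts assms] \<open>card ?F = arcs_from_to G A B\<close>
    by linarith
qed

end

text \<open>A map on \<open>V\<close> amounts to its restriction to \<open>V - {u, v}\<close>
  together with its two values at \<open>u\<close> and \<open>v\<close>. The condition
  \<open>Q\<close> stays abstract so that the same sum describes the count before and after
  orienting the edge.\<close>

lemma card_PiE_split_pair:
  assumes "finite V" "finite W" "u \<in> V" "v \<in> V" "u \<noteq> v"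
    and sub: "\<And>\<psi>. A \<psi> \<subseteq> W" "\<And>\<psi>. B \<psi> \<subseteq> W"
    and split: "\<And>\<psi> a b. \<lbrakk>\<psi> \<in> PiE (V - {u, v}) (\<lambda>_. W); a \<in> W; b \<in> W\<rbrakk>
      \<Longrightarrow> C (\<psi>(u := a, v := b)) \<longleftrightarrow> a \<in> A \<psi> \<and> b \<in> B \<psi>"
  shows "card {\<phi> \<in> PiE V (\<lambda>_. W). C \<phi> \<and> Q (\<phi> u) (\<phi> v)}
    = (\<Sum>\<psi> \<in> PiE (V - {u, v}) (\<lambda>_. W). card {(a, b) \<in> A \<psi> \<times> B \<psi>. Q a b})"
proof -
  let ?P = "PiE (V - {u, v}) (\<lambda>_. W)"
  let ?X = "SIGMA \<psi>:?P. {(a, b) \<in> A \<psi> \<times> B \<psi>. Q a b}"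
  let ?Y = "{\<phi> \<in> PiE V (\<lambda>_. W). C \<phi> \<and> Q (\<phi> u) (\<phi> v)}"
  let ?f = "\<lambda>(\<psi>, a, b). \<psi>(u := a, v := b)"
  let ?g = "\<lambda>\<phi>. (restrict \<phi> (V - {u, v}), \<phi> u, \<phi> v)"
  have fin: "finite {(a, b) \<in> A \<psi> \<times> B \<psi>. Q a b}" for \<psi>
    by (rule finite_subset[of _ "W \<times> W"]) (use sub assms(2) in auto)
  have glue: "(restrict \<phi> (V - {u, v}))(u := \<phi> u, v := \<phi> v) = \<phi>" if "\<phi> \<in> PiE V (\<lambda>_. W)" for \<phi>
    using that by (auto simp: fun_eq_iff PiE_def extensional_def)
  have "bij_betw ?f ?X ?Y"
  proof (rule bij_betw_byWitness[of _ ?g])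
    show "\<forall>p\<in>?X. ?g (?f p) = p"
      using \<open>u \<noteq> v\<close> by (auto simp: fun_eq_iff PiE_def extensional_def)
    show "\<forall>\<phi>\<in>?Y. ?f (?g \<phi>) = \<phi>"
      using glue by simp
    show "?f ` ?X \<subseteq> ?Y"
    proof clarify
      fix \<psi> a b
      assume *: "\<psi> \<in> ?P" "a \<in> A \<psi>" "b \<in> B \<psi>" "Q a b"
      then have "a \<in> W" "b \<in> W" using sub by blast+
      moreover from this have "\<psi>(u := a, v := b) \<in> PiE V (\<lambda>_. W)"
        using * assms(3,4) by (auto simp: PiE_iff extensional_def)
      ultimately show "\<psi>(u := a, v := b) \<in> PiE V (\<lambda>_. W) \<and> C (\<psi>(u := a, v := b))
          \<and> Q ((\<psi>(u := a, v := b)) u) ((\<psi>(u := a, v := b)) v)"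
        using * split[of \<psi> a b] \<open>u \<noteq> v\<close> by simp
    qed
    show "?g ` ?Y \<subseteq> ?X"
    proof
      fix p assume "p \<in> ?g ` ?Y"
      then obtain \<phi> where \<phi>: "\<phi> \<in> PiE V (\<lambda>_. W)" "C \<phi>" "Q (\<phi> u) (\<phi> v)" and p: "p = ?g \<phi>"
        by blast
      have "restrict \<phi> (V - {u, v}) \<in> ?P" "\<phi> u \<in> W" "\<phi> v \<in> W"
        using \<phi>(1) assms(3,4) by (auto simp: PiE_iff)
      then show "p \<in> ?X"
        using split[of "restrict \<phi> (V - {u, v})" "\<phi> u" "\<phi> v"] \<phi> glue[OF \<phi>(1)] p by simp
    qed
  qed
  then have "card ?Y = card ?X"
    by (simp add: bij_betw_same_card)
  also have "\<dots> = (\<Sum>\<psi>\<in>?P. card {(a, b) \<in> A \<psi> \<times> B \<psi>. Q a b})"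
    using fin assms(1,2) by (intro card_SigmaI) (auto intro: finite_PiE)
  finally show ?thesis .
qed

text \<open>Once the other images are fixed, the admissible values at \<open>u\<close> and
  \<open>v\<close> form a product, to which \<open>card_adjacent_pairs_le\<close> applies. Each of
  the \<open>card (pverts G) ^ (card V - 2)\<close> choices costs one \<open>bias G\<close>.\<close>

lemma (in oriented_graph) card_orient_edge_le:
  fixes V :: "'v set" and F :: "('v \<times> 'v) set" and R :: "'v \<times> 'v \<Rightarrow> 'a \<Rightarrow> 'a \<Rightarrow> bool"
  assumes "finite V" "u \<in> V" "v \<in> V" "u \<noteq> v" "(u, v) \<notin> F" "(v, u) \<notin> F"
  defines "C \<equiv> \<lambda>\<phi>. \<forall>(x, y) \<in> F. R (x, y) (\<phi> x) (\<phi> y)"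
  shows "card {\<phi> \<in> PiE V (\<lambda>_. pverts G).
        C \<phi> \<and> ((\<phi> u, \<phi> v) \<in> parcs G \<or> (\<phi> v, \<phi> u) \<in> parcs G)}
    \<le> 3 * card {\<phi> \<in> PiE V (\<lambda>_. pverts G). C \<phi> \<and> (\<phi> u, \<phi> v) \<in> parcs G}
      + card (pverts G) ^ (card V - 2) * bias G"
proof -
  let ?W = "pverts G"
  let ?P = "PiE (V - {u, v}) (\<lambda>_. ?W)"
  \<comment> \<open>Pairs of \<open>F\<close> avoiding both \<open>u\<close> and \<open>v\<close>
    are tested in \<open>A\<close> as well as in \<open>B\<close>; if one of them fails, both sets
    are empty.\<close>
  define A where "A \<psi> = {a \<in> ?W. \<forall>(x, y) \<in> F. x \<noteq> v \<longrightarrow> y \<noteq> v \<longrightarrow>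
    R (x, y) ((\<psi>(u := a)) x) ((\<psi>(u := a)) y)}" for \<psi>
  define B where "B \<psi> = {b \<in> ?W. \<forall>(x, y) \<in> F. x \<noteq> u \<longrightarrow> y \<noteq> u \<longrightarrow>
    R (x, y) ((\<psi>(v := b)) x) ((\<psi>(v := b)) y)}" for \<psi>
  have AB: "A \<psi> \<subseteq> ?W" "B \<psi> \<subseteq> ?W" for \<psi>
    by (auto simp: A_def B_def)
  have split: "C (\<psi>(u := a, v := b)) \<longleftrightarrow> a \<in> A \<psi> \<and> b \<in> B \<psi>" if "a \<in> ?W" "b \<in> ?W" for \<psi> a b
  proof
    assume "C (\<psi>(u := a, v := b))"
    then have c: "R (x, y) ((\<psi>(u := a, v := b)) x) ((\<psi>(u := a, v := b)) y)"
      if "(x, y) \<in> F" for x y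
      using that unfolding C_def by blast
    show "a \<in> A \<psi> \<and> b \<in> B \<psi>"
      unfolding A_def B_def using \<open>a \<in> ?W\<close> \<open>b \<in> ?W\<close> by (auto dest!: c split: if_splits)
  next
    assume ab: "a \<in> A \<psi> \<and> b \<in> B \<psi>"
    show "C (\<psi>(u := a, v := b))"
      unfolding C_def
    proof clarify
      fix x y assume xy: "(x, y) \<in> F"
      \<comment> \<open>A pair meeting both \<open>u\<close> and \<open>v\<close> would be
        \<open>(u, v)\<close> or \<open>(v, u)\<close>, and neither lies in
        \<open>F\<close>.\<close>
      then consider "x \<noteq> v" "y \<noteq> v" | "x \<noteq> u" "y \<noteq> u"
        using assms(4-6) by blast
      then show "R (x, y) ((\<psi>(u := a, v := b)) x) ((\<psi>(u := a, v := b)) y)"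
      proof cases
        case 1
        then show ?thesis using ab xy unfolding A_def by fastforce
      next
        case 2
        then show ?thesis using ab xy unfolding B_def by fastforce
      qed
    qed
  qed
  have count: "card {\<phi> \<in> PiE V (\<lambda>_. ?W). C \<phi> \<and> Q (\<phi> u) (\<phi> v)}
    = (\<Sum>\<psi>\<in>?P. card {(a, b) \<in> A \<psi> \<times> B \<psi>. Q a b})" for Q
    by (rule card_PiE_split_pair) (use assms(1-4) AB split in auto)
  have "card (V - {u, v}) = card V - 2"
    using assms(1-4) by (simp add: card_Diff_subset)
  then have card_P: "card ?P = card ?W ^ (card V - 2)"
    using assms(1) by (simp add: card_PiE)
  have "(\<Sum>\<psi>\<in>?P. card {(a, b) \<in> A \<psi> \<times> B \<psi>. (a, b) \<in> parcs G \<or> (b, a) \<in> parcs G})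
    \<le> (\<Sum>\<psi>\<in>?P. 3 * card {(a, b) \<in> A \<psi> \<times> B \<psi>. (a, b) \<in> parcs G} + bias G)"
    by (rule sum_mono) (rule card_adjacent_pairs_le[OF AB])
  then show ?thesis
    using count[of "\<lambda>a b. (a, b) \<in> parcs G \<or> (b, a) \<in> parcs G"]
      count[of "\<lambda>a b. (a, b) \<in> parcs G"] card_P
    by (simp add: sum.distrib sum_distrib_left)
qed

text \<open>The arcs in \<open>S\<close> must be mapped to arcs, the other arcs of \<open>H\<close> only to edges.\<close>

definition mixed_homs ::
  "'a pair_pre_digraph \<Rightarrow> 'b pair_pre_digraph \<Rightarrow> ('a \<times> 'a) set \<Rightarrow> ('a \<Rightarrow> 'b) set" where
  "mixed_homs H D S = {\<phi> \<in> PiE (pverts H) (\<lambda>_. pverts D). \<forall>(x, y) \<in> parcs H.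
     (\<phi> x, \<phi> y) \<in> parcs D \<or> (x, y) \<notin> S \<and> (\<phi> y, \<phi> x) \<in> parcs D}"

lemma card_mixed_homs_insert:
  assumes "oriented_graph H" "oriented_graph D" "(u, v) \<in> parcs H" "(u, v) \<notin> S"
  shows "card (mixed_homs H D S) \<le> 3 * card (mixed_homs H D (insert (u, v) S))
    + card (pverts D) ^ (card (pverts H) - 2) * bias D"
proof -
  interpret H: oriented_graph H by fact
  interpret D: oriented_graph D by fact
  define F where "F = parcs H - {(u, v)}"
  \<comment> \<open>The constraint depends on the arc \<open>e\<close> through membership in
    \<open>S\<close>. As \<open>(u, v)\<close> is not in \<open>F\<close>, the same \<open>R\<close>
    serves for \<open>S\<close> and for \<open>insert (u, v) S\<close>.\<close>
  define R where "R = (\<lambda>e a b. (a, b) \<in> parcs D \<or> e \<notin> S \<and> (b, a) \<in> parcs D)"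
  have uv: "u \<in> pverts H" "v \<in> pverts H" "u \<noteq> v"
    using assms(3) H.in_arcsD1 H.in_arcsD2 H.no_loops' by blast+
  have F: "(u, v) \<notin> F" "(v, u) \<notin> F"
    using H.no_opposite_arcs[OF assms(3)] by (auto simp: F_def)
  have "parcs H = insert (u, v) F"
    using assms(3) by (auto simp: F_def)
  then have "mixed_homs H D S = {\<phi> \<in> PiE (pverts H) (\<lambda>_. pverts D).
      (\<forall>(x, y) \<in> F. R (x, y) (\<phi> x) (\<phi> y)) \<and> ((\<phi> u, \<phi> v) \<in> parcs D \<or> (\<phi> v, \<phi> u) \<in> parcs D)}"
    and "mixed_homs H D (insert (u, v) S) = {\<phi> \<in> PiE (pverts H) (\<lambda>_. pverts D).
      (\<forall>(x, y) \<in> F. R (x, y) (\<phi> x) (\<phi> y)) \<and> (\<phi> u, \<phi> v) \<in> parcs D}"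
    using assms(4) F(1) unfolding mixed_homs_def R_def by (auto split: prod.splits; blast)+
  then show ?thesis
    using D.card_orient_edge_le[OF H.pair_finite_verts uv F, of R] by simp
qed

text \<open>Iterating the one-arc bound over \<open>T\<close> adds up
  \<open>1/3 + 1/9 + ... + 1/3 ^ card T\<close>, which is \<open>(1 - 1 / 3 ^ card T) / 2\<close>.
  The set \<open>S\<close> varies in the induction because it absorbs the arcs already
  oriented.\<close>

lemma card_mixed_homs_union:
  fixes \<epsilon> :: real
  assumes "oriented_graph H" "oriented_graph D"
    and bias: "real (bias D) \<le> \<epsilon> * real (card (pverts D)) ^ 2"
    and "finite T" "T \<subseteq> parcs H" "S \<inter> T = {}"
  shows "real (card (mixed_homs H D S)) / 3 ^ card T
    \<le> real (card (mixed_homs H D (S \<union> T)))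
      + \<epsilon> / 2 * real (card (pverts D)) ^ card (pverts H) * (1 - 1 / 3 ^ card T)"
  using assms(4-6)
proof (induction T arbitrary: S rule: finite_induct)
  case empty
  then show ?case by simp
next
  case (insert e T)
  interpret H: oriented_graph H by fact
  obtain u v where e: "e = (u, v)" by (cases e)
  let ?n = "real (card (pverts D))" and ?k = "card (pverts H)"
  let ?m = "\<lambda>S. real (card (mixed_homs H D S))"
  have uv: "(u, v) \<in> parcs H" "(u, v) \<notin> S"
    using insert.prems e by auto
  \<comment> \<open>The ends of an arc are two distinct vertices, so the subtraction in
    \<open>?k - 2\<close> does not truncate and \<open>?n ^ (?k - 2) * ?n ^ 2\<close> is
    \<open>?n ^ ?k\<close>.\<close>
  have "{u, v} \<subseteq> pverts H" "u \<noteq> v"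
    using uv(1) H.in_arcsD1 H.in_arcsD2 H.no_loops' by blast+
  then have k: "2 \<le> ?k"
    using card_mono[OF H.pair_finite_verts, of "{u, v}"] by simp
  have "real (card (mixed_homs H D S)) \<le> real (3 * card (mixed_homs H D (insert (u, v) S))
      + card (pverts D) ^ (?k - 2) * bias D)"
    using card_mixed_homs_insert[OF assms(1,2) uv] by (simp only: of_nat_le_iff)
  then have "?m S \<le> 3 * ?m (insert e S) + ?n ^ (?k - 2) * real (bias D)"
    by (simp add: e)
  also have "?n ^ (?k - 2) * real (bias D) \<le> ?n ^ (?k - 2) * (\<epsilon> * ?n ^ 2)"
    using bias by (intro mult_left_mono) auto
  also have "\<dots> = \<epsilon> * ?n ^ (?k - 2 + 2)"
    by (simp only: power_add mult.left_commute)
  also have "?k - 2 + 2 = ?k"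
    using k by simp
  finally have "?m S \<le> 3 * ?m (insert e S) + \<epsilon> * ?n ^ ?k" by simp
  then have "?m S / 3 ^ Suc (card T) \<le> (3 * ?m (insert e S) + \<epsilon> * ?n ^ ?k) / 3 ^ Suc (card T)"
    by (rule divide_right_mono) simp
  also have "\<dots> = ?m (insert e S) / 3 ^ card T + \<epsilon> * ?n ^ ?k / 3 ^ Suc (card T)"
    by (simp add: add_divide_distrib)
  also have "?m (insert e S) / 3 ^ card T
      \<le> ?m (insert e S \<union> T) + \<epsilon> / 2 * ?n ^ ?k * (1 - 1 / 3 ^ card T)"
    using insert by (intro insert.IH) auto
  finally show ?case
    using insert.hyps by (simp add: field_simps)
qed

theorem theorem1p7:
  fixes H :: "'a pair_pre_digraph" and D :: "'b pair_pre_digraph"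
    and k n :: nat and \<epsilon> :: real
  assumes "oriented_graph H" and "card (pverts H) = k"
    and "oriented_graph D" and "card (pverts D) = n"
    and "real (bias D) < \<epsilon> * real n ^ 2"
  shows "real (hom_count H D)
    \<ge> real (unoriented_hom_count (mk_symmetric H) D) / 3 ^ card (parcs H) - \<epsilon> / 2 * real n ^ k"
proof -
  interpret H: oriented_graph H by fact
  \<comment> \<open>The bias is a natural number, so the strict bound on it fixes the sign of
    \<open>\<epsilon>\<close>; this allows the factor \<open>1 - 1 / 3 ^ card (parcs H)\<close> to
    be replaced by 1 at the end.\<close>
  have "0 < \<epsilon> * real n ^ 2"
    using assms(5) by (rule le_less_trans[rotated]) simp
  then have "0 \<le> \<epsilon>"
    by (simp add: zero_less_mult_iff)
  \<comment> \<open>The reversed arcs of \<open>mk_symmetric H\<close> only repeat the symmetric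
    adjacency condition.\<close>
  have unoriented: "unoriented_hom_count (mk_symmetric H) D = card (mixed_homs H D {})"
    unfolding unoriented_hom_count_def mixed_homs_def
    by (rule arg_cong[where f = card]) (auto simp: parcs_mk_symmetric)
  have oriented: "hom_count H D = card (mixed_homs H D ({} \<union> parcs H))"
    unfolding hom_count_def mixed_homs_def by (rule arg_cong[where f = card]) auto
  have "real (card (mixed_homs H D {})) / 3 ^ card (parcs H)
    \<le> real (card (mixed_homs H D ({} \<union> parcs H)))
      + \<epsilon> / 2 * real n ^ k * (1 - 1 / 3 ^ card (parcs H))"
    using card_mixed_homs_union[of H D \<epsilon> "parcs H" "{}"] assms H.pair_finite_arcs by simp
  moreover have "\<epsilon> / 2 * real n ^ k * (1 - 1 / 3 ^ card (parcs H)) \<le> \<epsilon> / 2 * real n ^ k * 1"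
    using \<open>0 \<le> \<epsilon>\<close> by (intro mult_left_mono) auto
  ultimately show ?thesis
    unfolding unoriented oriented by linarith
qed

end
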